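(* Suppose that $A$ is self-adjoint and that $Ae_i=\lambda_ie_i$ for all $i\in\mathbb{N}$, where $\lambda_i\in\mathbb{R}$. Fix $n\in\mathbb{N}$ and a finite set $I\subset\mathbb{N}$, and assume: (1) the set $\mathcal{F}_I=\{p=\{p_i\}_{i=1}^\infty\in\Delta\cap X\mid p_i=0 \text{ for all } i\notin I\}$ is nonempty; (2) $W_iW_j=W_jW_i$ for all $i,j\in\mathbb{N}$; let $\{z_k\}_{k=1}^\infty$ be a complete orthonormal system of $\mathcal{H}$ and $\lambda_k^{(i)}\ge 0$ be such that $W_iz=\sum_{k=1}^\infty\lambda_k^{(i)}\langle z,z_k\rangle z_k$ for all $z\in\mathcal{H}$ and all $i\in\mathbb{N}$ (such a system exists by the commutativity); (3) there exist $n$ distinct elements $z_{\sigma(1)},\dots,z_{\sigma(n)}$ of $\{z_k\}_{k=1}^\infty$ such that for every $i\in I$ the restriction of $W_i$ to $\left(\operatorname{span}\{z_{\sigma(1)},\dots,z_{\sigma(n)}\}\right)^\perp$ is $0$. Then the optimal solution $p$ (the Volumetric Controllability Score) of $$\text{minimize } f(p)=-\log\prod_{k=1}^n\mu_k(W(p)) \quad\text{subject to } p\in\mathcal{F}_I$$ is given by $p_i=\frac1n$ for all $i\in I$.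
   Context: $\mathcal{H}$ is an infinite-dimensional separable real Hilbert space with a fixed complete orthonormal system $\{e_i\}_{i=1}^\infty$. $A$ is the infinitesimal generator of a strongly continuous semigroup $\exp(tA)$ on $\mathcal{H}$ that is exponentially stable: there are constants $M,\omega>0$ with $\|\exp(tA)\|\le M e^{-\omega t}$ for all $t\ge 0$. $\Delta=\{\{p_i\}_{i=1}^\infty \mid p_i\ge 0,\ \sum_{i=1}^\infty p_i=1\}$. For $p\in\Delta$, $B=B(p)$ is the bounded linear operator on $\mathcal{H}$ with $Be_i=\sqrt{p_i}\,e_i$ for all $i\in\mathbb{N}$, and the controllability Gramian is $$W(p)=\int_0^\infty \exp(tA)BB^*\exp(tA)^*\,\mathrm{d}t .$$ $W(p)$ is a compact, self-adjoint, positive semidefinite operator; $\mu_k(W(p))$ denotes its $k$-th eigenvalue when the eigenvalues are listed in descending order, counted with multiplicity. For the fixed $n$, $X=\{\{p_i\}_{i=1}^\infty\mid \mu_n(W(p))>0\}$. For $i\in\mathbb{N}$, $P_i$ is the orthogonal projection $P_iz=\langle z,e_i\rangle e_i$ and $$W_i=\int_0^\infty\exp(tA)P_iP_i^*\exp(tA)^*\,\mathrm{d}t .$$ *)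

theory Defs
  imports "HOL-Analysis.Analysis"
begin

text \<open>
  Sequences indexed by \<open>\<nat> = {1, 2, \<dots>}\<close> in the mathematics (orthonormal systems, \<open>p\<close>) are
  indexed by \<^typ>\<open>nat\<close> from \<open>0\<close> here; eigenvalues \<open>\<mu>\<^sub>k\<close> keep their numbering \<open>k \<ge> 1\<close>.
  A Hilbert space is a type of class \<^class>\<open>real_inner\<close> and \<^class>\<open>complete_space\<close>;
  separability is \<^class>\<open>second_countable_topology\<close>, and infinite dimension is forced by the
  existence of an orthonormal sequence.
\<close>

definition complete_orthonormal :: "(nat \<Rightarrow> 'a::{real_inner, complete_space}) \<Rightarrow> bool" where
  "complete_orthonormal e \<longleftrightarrow>
     (\<forall>i j. e i \<bullet> e j = (if i = j then 1 else 0)) \<and> closure (span (range e)) = UNIV"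

definition c0_semigroup :: "(real \<Rightarrow> 'a::real_normed_vector \<Rightarrow>\<^sub>L 'a) \<Rightarrow> bool" where
  "c0_semigroup S \<longleftrightarrow>
     S 0 = id_blinfun \<and>
     (\<forall>s\<ge>0. \<forall>t\<ge>0. S (s + t) = S s o\<^sub>L S t) \<and>
     (\<forall>x. ((\<lambda>t. S t x) \<longlongrightarrow> x) (at_right 0))"

definition exponentially_stable :: "(real \<Rightarrow> 'a::real_normed_vector \<Rightarrow>\<^sub>L 'a) \<Rightarrow> bool" where
  "exponentially_stable S \<longleftrightarrow>
     (\<exists>M \<omega>. M > 0 \<and> \<omega> > 0 \<and> (\<forall>t\<ge>0. norm (S t) \<le> M * exp (- \<omega> * t)))"

text \<open>
  An unbounded operator is a pair of its domain \<open>D\<close> and a function \<open>A\<close>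
  whose values outside \<open>D\<close> are irrelevant.
\<close>

definition is_generator ::
    "'a set \<Rightarrow> ('a \<Rightarrow> 'a) \<Rightarrow> (real \<Rightarrow> 'a::real_normed_vector \<Rightarrow>\<^sub>L 'a) \<Rightarrow> bool" where
  "is_generator D A S \<longleftrightarrow>
     D = {x. \<exists>y. ((\<lambda>h. (S h x - x) /\<^sub>R h) \<longlongrightarrow> y) (at_right 0)} \<and>
     (\<forall>x\<in>D. ((\<lambda>h. (S h x - x) /\<^sub>R h) \<longlongrightarrow> A x) (at_right 0))"

text \<open>The equivalence says that the graphs of \<open>A\<close> and of its Hilbert space adjoint coincide,
  domains included.\<close>

definition self_adjoint_on :: "'a::real_inner set \<Rightarrow> ('a \<Rightarrow> 'a) \<Rightarrow> bool" where
  "self_adjoint_on D A \<longleftrightarrow>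
     closure D = UNIV \<and>
     (\<forall>u v. (u \<in> D \<and> A u = v) \<longleftrightarrow> (\<forall>x\<in>D. A x \<bullet> u = x \<bullet> v))"

definition prob_seqs :: "(nat \<Rightarrow> real) set" where
  "prob_seqs = {p. (\<forall>i. p i \<ge> 0) \<and> p sums 1}"

definition input_op ::
    "(nat \<Rightarrow> 'a::{real_inner, complete_space}) \<Rightarrow> (nat \<Rightarrow> real) \<Rightarrow> 'a \<Rightarrow>\<^sub>L 'a" where
  "input_op e p = (THE B. \<forall>i. blinfun_apply B (e i) = sqrt (p i) *\<^sub>R e i)"

text \<open>
  The operator-valued integral \<open>\<integral>\<^sub>0\<^sup>\<infinity> exp(tA) C C\<^sup>* exp(tA)\<^sup>* dt\<close> is taken in the strong sense:
  its value at \<open>x\<close> is the Bochner integral of the integrand applied to \<open>x\<close>.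
\<close>

definition gramian_of ::
    "(real \<Rightarrow> 'a::{real_inner, complete_space, second_countable_topology} \<Rightarrow>\<^sub>L 'a) \<Rightarrow>
     ('a \<Rightarrow> 'a) \<Rightarrow> 'a \<Rightarrow> 'a" where
  "gramian_of S C x =
     (LINT t:{0..}|lborel. S t (C (adjoint C (adjoint (blinfun_apply (S t)) x))))"

definition gramian ::
    "(real \<Rightarrow> 'a::{real_inner, complete_space, second_countable_topology} \<Rightarrow>\<^sub>L 'a) \<Rightarrow>
     (nat \<Rightarrow> 'a) \<Rightarrow> (nat \<Rightarrow> real) \<Rightarrow> 'a \<Rightarrow> 'a" where
  "gramian S e p = gramian_of S (blinfun_apply (input_op e p))"

definition coord_proj :: "(nat \<Rightarrow> 'a::real_inner) \<Rightarrow> nat \<Rightarrow> 'a \<Rightarrow> 'a" where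
  "coord_proj e i x = (x \<bullet> e i) *\<^sub>R e i"

definition gramian_i ::
    "(real \<Rightarrow> 'a::{real_inner, complete_space, second_countable_topology} \<Rightarrow>\<^sub>L 'a) \<Rightarrow>
     (nat \<Rightarrow> 'a) \<Rightarrow> nat \<Rightarrow> 'a \<Rightarrow> 'a" where
  "gramian_i S e i = gramian_of S (coord_proj e i)"

text \<open>
  \<open>m 0 \<ge> m 1 \<ge> \<dots>\<close> lists the eigenvalues of a compact positive semidefinite operator on an
  infinite-dimensional space in descending order, each positive one as often as its
  multiplicity (the size of a basis of its eigenspace). If there are only finitely many
  positive eigenvalues, the list continues with zeros; otherwise \<open>0\<close> does not occur in it.
\<close>

definition eigenvalue_listing ::
    "('a::real_inner \<Rightarrow> 'a) \<Rightarrow> (nat \<Rightarrow> real) \<Rightarrow> bool" where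
  "eigenvalue_listing T m \<longleftrightarrow>
     decseq m \<and> (\<forall>k. m k \<ge> 0) \<and>
     (\<forall>\<mu>>0. finite {k. m k = \<mu>} \<and>
       (\<exists>b. finite b \<and> independent b \<and> span b = {x. T x = \<mu> *\<^sub>R x} \<and>
            card b = card {k. m k = \<mu>}))"

definition kth_eigenvalue :: "nat \<Rightarrow> ('a::real_inner \<Rightarrow> 'a) \<Rightarrow> real" where
  "kth_eigenvalue k T = (THE m. eigenvalue_listing T m) (k - 1)"

definition positive_nth ::
    "(real \<Rightarrow> 'a::{real_inner, complete_space, second_countable_topology} \<Rightarrow>\<^sub>L 'a) \<Rightarrow>
     (nat \<Rightarrow> 'a) \<Rightarrow> nat \<Rightarrow> (nat \<Rightarrow> real) set" where
  "positive_nth S e n = {p. kth_eigenvalue n (gramian S e p) > 0}"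

definition feasible ::
    "(real \<Rightarrow> 'a::{real_inner, complete_space, second_countable_topology} \<Rightarrow>\<^sub>L 'a) \<Rightarrow>
     (nat \<Rightarrow> 'a) \<Rightarrow> nat \<Rightarrow> nat set \<Rightarrow> (nat \<Rightarrow> real) set" where
  "feasible S e n I = {p \<in> prob_seqs \<inter> positive_nth S e n. \<forall>i. i \<notin> I \<longrightarrow> p i = 0}"

definition vol_objective ::
    "(real \<Rightarrow> 'a::{real_inner, complete_space, second_countable_topology} \<Rightarrow>\<^sub>L 'a) \<Rightarrow>
     (nat \<Rightarrow> 'a) \<Rightarrow> nat \<Rightarrow> (nat \<Rightarrow> real) \<Rightarrow> real" where
  "vol_objective S e n p = - ln (\<Prod>k=1..n. kth_eigenvalue k (gramian S e p))"

end

theory Submission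
  imports Defs
begin

text \<open>
  Each \<open>e i\<close> is an eigenvector of the semigroup, so for \<open>p\<close> supported in the finite set \<open>I\<close> the Gramian
  is diagonal in \<open>e\<close> with entries \<open>p\<^sub>i / (- 2 \<lambda>\<^sub>i)\<close> for \<open>i \<in> I\<close>. Hypothesis (3) puts every \<open>e i\<close> with \<open>i \<in> I\<close>
  into an \<open>n\<close>-dimensional space, while feasibility requires at least \<open>n\<close> positive diagonal entries; hence
  \<open>card I = n\<close>, and the objective is a constant plus \<open>- (\<Sum>i\<in>I. ln (p i))\<close>, which the uniform weights minimize
  by \<open>ln x \<le> x - 1\<close>.
\<close>

section \<open>Complete orthonormal systems\<close>

lemma complete_orthonormal_inner:
  assumes "complete_orthonormal e"
  shows "e i \<bullet> e j = (if i = j then 1 else 0)"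
  using assms by (simp add: complete_orthonormal_def)

lemma complete_orthonormal_inj:
  assumes "complete_orthonormal e"
  shows "inj e"
  by (rule injI) (metis assms complete_orthonormal_inner zero_neq_one)

lemma complete_orthonormal_independent:
  assumes "complete_orthonormal e"
  shows "independent (e ` J)"
proof (rule pairwise_orthogonal_independent)
  show "pairwise orthogonal (e ` J)"
    using complete_orthonormal_inner[OF assms] by (auto simp: pairwise_def orthogonal_def)
  show "0 \<notin> e ` J"
    by (metis complete_orthonormal_inner[OF assms] image_iff inner_zero_left zero_neq_one)
qed

text \<open>The set where \<open>f\<close> and \<open>g\<close> agree is closed and contains the
  dense subspace \<open>span (range e)\<close>. The codomain is arbitrary, so this serves for
  operators and for inner products alike.\<close>

lemma bounded_linear_eq_on_orthonormal:
  assumes e: "complete_orthonormal e" and f: "bounded_linear f" and g: "bounded_linear g"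
    and eq: "\<And>i. f (e i) = g (e i)"
  shows "f x = g x"
proof -
  let ?E = "{x. f x = g x}"
  have "closed ?E"
    by (intro closed_Collect_eq linear_continuous_on f g)
  moreover have "span (range e) \<subseteq> ?E"
    using linear_eq_on_span[OF bounded_linear.linear[OF f] bounded_linear.linear[OF g], of "range e"] eq
    by blast
  ultimately have "closure (span (range e)) \<subseteq> ?E"
    by (rule closure_minimal[rotated])
  then show ?thesis
    using e by (auto simp: complete_orthonormal_def)
qed

section \<open>Eigenvectors of the semigroup\<close>

lemma semigroup_eigenvector:
  fixes S :: "real \<Rightarrow> 'a::real_normed_vector \<Rightarrow>\<^sub>L 'a"
  assumes S: "c0_semigroup S" and bound: "\<And>t. t \<ge> 0 \<Longrightarrow> norm (S t) \<le> C"
    and deriv: "((\<lambda>h. (S h x - x) /\<^sub>R h) \<longlongrightarrow> r *\<^sub>R x) (at_right 0)"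
    and t: "t \<ge> 0"
  shows "S t x = exp (r * t) *\<^sub>R x"
proof (cases "t = 0")
  case True
  then show ?thesis
    using S by (simp add: c0_semigroup_def)
next
  case False
  with t have t: "t > 0" by simp
  \<comment> \<open>\<open>exp (- r t) S t\<close> moves \<open>x\<close> by at most \<open>K\<close> times the sum of \<open>k\<close> displacements of size
    \<open>o(t / k)\<close>, so that only the derivative at \<open>0\<close> is needed.\<close>
  define T where "T h = exp (- r * h) *\<^sub>R S h x - x" for h
  define K where "K = exp (\<bar>r\<bar> * t) * C"
  have C: "C \<ge> 0"
    using bound[of 0] norm_ge_zero[of "S 0"] by linarith
  have iter: "norm (T (real k * h)) \<le> real k * (K * norm (T h))"
    if "h \<ge> 0" "real k * h \<le> t" for k h
    using that(2)
  proof (induction k)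
    case 0
    then show ?case
      using S by (simp add: T_def c0_semigroup_def)
  next
    case (Suc k)
    let ?s = "real k * h"
    have s: "0 \<le> ?s" "?s \<le> t"
      using Suc.prems that(1) by (auto simp: algebra_simps)
    have "S (?s + h) x = S ?s (S h x)"
      using S s that(1) by (simp add: c0_semigroup_def)
    moreover have "exp (- r * (?s + h)) = exp (- r * ?s) * exp (- r * h)"
      by (simp add: algebra_simps flip: exp_add)
    \<comment> \<open>The displacement over \<open>?s + h\<close> is the one over \<open>h\<close>,
      transported by \<open>exp (- r * ?s) S ?s\<close>, plus the one over
      \<open>?s\<close>.\<close>
    ultimately have "T (?s + h) = exp (- r * ?s) *\<^sub>R S ?s (T h) + T ?s"
      by (simp add: T_def blinfun.diff_right blinfun.scaleR_right scaleR_diff_right)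
    then have "T (real (Suc k) * h) = exp (- r * ?s) *\<^sub>R S ?s (T h) + T ?s"
      by (simp add: distrib_right add.commute)
    \<comment> \<open>\<open>K\<close> bounds the norm of \<open>exp (- r s) S s\<close> for all
      \<open>s\<close> in \<open>[0, t]\<close>; the absolute value in \<open>K\<close> covers both
      signs of \<open>r\<close>.\<close>
    moreover have "norm (exp (- r * ?s) *\<^sub>R S ?s (T h)) \<le> K * norm (T h)"
    proof -
      have "- r * ?s \<le> \<bar>r\<bar> * ?s"
        using s by (intro mult_right_mono) auto
      also have "\<dots> \<le> \<bar>r\<bar> * t"
        using s by (intro mult_left_mono) auto
      finally have "- r * ?s \<le> \<bar>r\<bar> * t" .
      then have "exp (- r * ?s) \<le> exp (\<bar>r\<bar> * t)" by simp
      moreover have "norm (S ?s (T h)) \<le> C * norm (T h)"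
        by (rule order_trans[OF norm_blinfun mult_right_mono[OF bound[OF s(1)] norm_ge_zero]])
      ultimately have "exp (- r * ?s) * norm (S ?s (T h)) \<le> exp (\<bar>r\<bar> * t) * (C * norm (T h))"
        by (intro mult_mono) auto
      then show ?thesis by (simp add: K_def)
    qed
    ultimately have "norm (T (real (Suc k) * h)) \<le> K * norm (T h) + norm (T ?s)"
      by (metis add_right_mono norm_triangle_le)
    then show ?case
      using Suc.IH s by (simp add: algebra_simps)
  qed
  \<comment> \<open>Product rule: the right derivative of \<open>exp (- r h) S h x\<close> at
    \<open>0\<close> is \<open>r x - r x = 0\<close>.\<close>
  have lim0: "((\<lambda>h. T h /\<^sub>R h) \<longlongrightarrow> 0) (at_right 0)"
  proof -
    have "((\<lambda>h. exp (- r * h)) has_real_derivative - r) (at 0)"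
      by (auto intro!: derivative_eq_intros)
    then have "((\<lambda>h. (exp (- r * h) - 1) / h) \<longlongrightarrow> - r) (at_right 0)"
      by (auto simp: has_field_derivative_iff intro: tendsto_mono[OF at_le])
    moreover have "((\<lambda>h. exp (- r * h)) \<longlongrightarrow> exp (- r * 0)) (at_right 0)"
      by (intro tendsto_intros)
    ultimately have "((\<lambda>h. exp (- r * h) *\<^sub>R ((S h x - x) /\<^sub>R h) + ((exp (- r * h) - 1) / h) *\<^sub>R x)
        \<longlongrightarrow> exp (- r * 0) *\<^sub>R (r *\<^sub>R x) + (- r) *\<^sub>R x) (at_right 0)"
      by (intro tendsto_intros deriv)
    moreover have "exp (- r * h) *\<^sub>R ((S h x - x) /\<^sub>R h) + ((exp (- r * h) - 1) / h) *\<^sub>R x = T h /\<^sub>R h" for h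
      by (simp add: T_def algebra_simps divide_inverse)
    ultimately show ?thesis by simp
  qed
  have "(\<lambda>k. t / real (Suc k)) \<longlonglongrightarrow> 0"
    using LIMSEQ_Suc[OF lim_const_over_n[of t]] by simp
  then have "filterlim (\<lambda>k. t / real (Suc k)) (at_right 0) sequentially"
    using t by (auto simp: filterlim_at intro!: always_eventually)
  from filterlim_compose[OF lim0 this]
  have "(\<lambda>k. K * t * norm (T (t / real (Suc k)) /\<^sub>R (t / real (Suc k)))) \<longlonglongrightarrow> K * t * norm (0 :: 'a)"
    by (intro tendsto_intros)
  \<comment> \<open>For \<open>h = t / (k + 1)\<close>, the bound \<open>(k + 1) K |T h|\<close>
    from \<open>iter\<close> is \<open>K t |T h / h|\<close>, which tends to \<open>0\<close> by
    \<open>lim0\<close>.\<close>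
  moreover have "norm (T t) \<le> K * t * norm (T (t / real (Suc k)) /\<^sub>R (t / real (Suc k)))" for k
  proof -
    have "real (Suc k) * (t / real (Suc k)) = t" by simp
    then show ?thesis
      using iter[of "t / real (Suc k)" "Suc k"] t by (simp add: mult_ac)
  qed
  ultimately have "norm (T t) \<le> K * t * norm (0 :: 'a)"
    by (intro LIMSEQ_le_const) auto
  then have "exp (- r * t) *\<^sub>R S t x = x"
    by (simp add: T_def)
  then have "exp (r * t) *\<^sub>R (exp (- r * t) *\<^sub>R S t x) = exp (r * t) *\<^sub>R x" by simp
  then show ?thesis
    by (simp add: exp_minus)
qed

section \<open>Gramians of diagonal operators\<close>

text \<open>The scalar integral behind each Gramian entry, used with \<open>a = - 2 * r i\<close>;
  the antiderivative is \<open>- exp (- (a * t)) / a\<close>.\<close>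

lemma has_bochner_integral_exp_atLeast:
  fixes a :: real
  assumes "a > 0"
  shows "has_bochner_integral lborel (\<lambda>t. indicator {0..} t * exp (- (a * t))) (1 / a)"
proof -
  have lim: "((\<lambda>t::real. - exp (- (a * t)) / a) \<longlongrightarrow> - 0 / a) at_top"
    using assms by (intro tendsto_intros filterlim_compose[OF exp_at_bot])
      (auto simp: filterlim_uminus_at_bot intro!: filterlim_tendsto_pos_mult_at_top filterlim_ident tendsto_const)
  have "(\<integral>\<^sup>+t. ennreal (exp (- (a * t))) * indicator {0..} t \<partial>lborel) = ennreal (0 - (- exp (- (a * 0)) / a))"
    using assms lim
    by (intro nn_integral_FTC_atLeast) (auto intro!: derivative_eq_intros)
  then have "(\<integral>\<^sup>+t. ennreal (indicator {0..} t * exp (- (a * t))) \<partial>lborel) = ennreal (1 / a)"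
    by (subst nn_integral_cong[where v = "\<lambda>t. ennreal (exp (- (a * t))) * indicator {0..} t"])
      (auto split: split_indicator)
  then show ?thesis
    using assms by (intro has_bochner_integral_nn_integral) auto
qed

text \<open>Common form of the input operator, the coordinate projections and the Gramians.
  Restricting to a finite \<open>I\<close> keeps everything a finite sum, so no convergence question
  arises.\<close>

definition diag_op :: "(nat \<Rightarrow> 'a::real_inner) \<Rightarrow> nat set \<Rightarrow> (nat \<Rightarrow> real) \<Rightarrow> 'a \<Rightarrow> 'a" where
  "diag_op e I d x = (\<Sum>i\<in>I. (d i * (x \<bullet> e i)) *\<^sub>R e i)"

lemma bounded_linear_diag_op: "bounded_linear (diag_op e I d)"
proof -
  have "diag_op e I d = (\<lambda>x. \<Sum>i\<in>I. (d i * (x \<bullet> e i)) *\<^sub>R e i)"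
    by (simp add: diag_op_def fun_eq_iff)
  then show ?thesis
    by (auto intro!: bounded_linear_sum bounded_linear_scaleR_const bounded_linear_const_mult
        bounded_linear_inner_left)
qed

lemma adjoint_diag_op: "adjoint (diag_op e I d) = diag_op e I d"
  by (rule adjoint_unique)
    (auto simp: diag_op_def inner_sum_left inner_sum_right inner_commute intro!: sum.cong)

lemma inner_diag_op:
  assumes "complete_orthonormal e" "finite I"
  shows "diag_op e I d x \<bullet> e j = (if j \<in> I then d j * (x \<bullet> e j) else 0)"
  using assms by (simp add: diag_op_def inner_sum_left complete_orthonormal_inner if_distrib sum.delta cong: if_cong)

lemma diag_op_basis:
  assumes "complete_orthonormal e" "finite I"
  shows "diag_op e I d (e j) = (if j \<in> I then d j *\<^sub>R e j else 0)"
  using assms by (simp add: diag_op_def complete_orthonormal_inner if_distrib[of "\<lambda>a. _ * a"]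
      if_distrib[of "\<lambda>a. a *\<^sub>R _"] sum.delta cong: if_cong)

lemma diag_op_diag_op:
  assumes "complete_orthonormal e" "finite I"
  shows "diag_op e I c (diag_op e I d x) = diag_op e I (\<lambda>i. c i * d i) x"
  using inner_diag_op[OF assms] by (simp add: diag_op_def[of e I c] diag_op_def[of e I "\<lambda>i. c i * d i"] mult.assoc)

text \<open>Bounded operators are determined by their values on \<open>e\<close>, so the definite
  description in \<open>input_op\<close> has exactly this solution.\<close>

lemma input_op_eq_diag_op:
  assumes "complete_orthonormal e" "finite I" "\<And>i. i \<notin> I \<Longrightarrow> p i = 0"
  shows "blinfun_apply (input_op e p) = diag_op e I (\<lambda>i. sqrt (p i))"
proof -
  have "input_op e p = Blinfun (diag_op e I (\<lambda>i. sqrt (p i)))"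
    unfolding input_op_def
  proof (rule the_equality)
    show 1: "\<forall>i. blinfun_apply (Blinfun (diag_op e I (\<lambda>i. sqrt (p i)))) (e i) = sqrt (p i) *\<^sub>R e i"
      using assms by (auto simp: bounded_linear_Blinfun_apply bounded_linear_diag_op diag_op_basis)
    show "B = Blinfun (diag_op e I (\<lambda>i. sqrt (p i)))"
      if "\<forall>i. blinfun_apply B (e i) = sqrt (p i) *\<^sub>R e i" for B
      using that 1
      by - (rule blinfun_eqI, rule bounded_linear_eq_on_orthonormal[OF assms(1)
            blinfun.bounded_linear_right blinfun.bounded_linear_right], simp)
  qed
  then show ?thesis
    by (simp add: bounded_linear_Blinfun_apply bounded_linear_diag_op)
qed

text \<open>\<open>S t\<close> is diagonal in \<open>e\<close>, hence equal to its adjoint. The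
  integrand at \<open>x\<close> is then a finite sum of fixed vectors times decaying exponentials,
  integrated term by term.\<close>

lemma gramian_of_diag_op:
  fixes S :: "real \<Rightarrow> 'a::{real_inner, complete_space, second_countable_topology} \<Rightarrow>\<^sub>L 'a"
  assumes e: "complete_orthonormal e" and "finite I"
    and S: "\<And>t i. t \<ge> 0 \<Longrightarrow> S t (e i) = exp (r i * t) *\<^sub>R e i" and r: "\<And>i. r i < 0"
  shows "gramian_of S (diag_op e I s) = diag_op e I (\<lambda>i. (s i)\<^sup>2 / (- 2 * r i))"
proof
  fix x
  \<comment> \<open>Symmetry of \<open>S t\<close> takes two density arguments: \<open>x\<close>
    varies here against a fixed \<open>e j\<close>, and in \<open>adj\<close> the second vector
    varies.\<close>
  have sym: "S t x \<bullet> e j = x \<bullet> S t (e j)" if t: "t \<ge> 0" for t x j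
    by (rule bounded_linear_eq_on_orthonormal[OF e
          bounded_linear_compose[OF bounded_linear_inner_left blinfun.bounded_linear_right]
          bounded_linear_inner_left])
      (simp add: S t complete_orthonormal_inner[OF e])
  have adj: "adjoint (blinfun_apply (S t)) = blinfun_apply (S t)" if t: "t \<ge> 0" for t
  proof (rule adjoint_unique, intro allI)
    show "S t x \<bullet> y = x \<bullet> S t y" for x y
      by (rule bounded_linear_eq_on_orthonormal[OF e bounded_linear_inner_right
            bounded_linear_compose[OF bounded_linear_inner_right blinfun.bounded_linear_right]])
        (simp add: sym t)
  qed
  have inner: "S t x \<bullet> e i = exp (r i * t) * (x \<bullet> e i)" if "t \<ge> 0" for t i
    using that by (simp add: sym S)
  \<comment> \<open>One factor \<open>exp (r i * t)\<close> comes from \<open>S t\<close> and one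
    from its adjoint, which gives the rate \<open>- 2 * r i > 0\<close>.\<close>
  let ?u = "\<lambda>i t. indicator {0..} t * exp (- ((- 2 * r i) * t))"
  have "indicator {0..} t *\<^sub>R S t (diag_op e I s (adjoint (diag_op e I s) (adjoint (S t) x)))
      = (\<Sum>i\<in>I. ?u i t *\<^sub>R ((s i)\<^sup>2 * (x \<bullet> e i)) *\<^sub>R e i)" for t
  proof (cases "t \<ge> 0")
    case True
    then show ?thesis
      by (simp add: adj adjoint_diag_op diag_op_diag_op assms(1,2))
        (simp add: diag_op_def blinfun.sum_right blinfun.scaleR_right S inner power2_eq_square
          mult_exp_exp algebra_simps)
  qed simp
  moreover have "has_bochner_integral lborel (\<lambda>t. \<Sum>i\<in>I. ?u i t *\<^sub>R ((s i)\<^sup>2 * (x \<bullet> e i)) *\<^sub>R e i)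
      (\<Sum>i\<in>I. (1 / (- 2 * r i)) *\<^sub>R ((s i)\<^sup>2 * (x \<bullet> e i)) *\<^sub>R e i)"
    using r by (intro has_bochner_integral_sum has_bochner_integral_scaleR_left
        has_bochner_integral_exp_atLeast) auto
  ultimately have "gramian_of S (diag_op e I s) x
      = (\<Sum>i\<in>I. (1 / (- 2 * r i)) *\<^sub>R ((s i)\<^sup>2 * (x \<bullet> e i)) *\<^sub>R e i)"
    unfolding gramian_of_def set_lebesgue_integral_def
    by (simp only: has_bochner_integral_integral_eq)
  then show "gramian_of S (diag_op e I s) x = diag_op e I (\<lambda>i. (s i)\<^sup>2 / (- 2 * r i)) x"
    by (simp add: diag_op_def)
qed

section \<open>Eigenvalue listings\<close>

text \<open>Both counts are the dimension of the eigenspace for \<open>v\<close>.\<close>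

lemma eigenvalue_listing_card_eq:
  assumes "eigenvalue_listing T m" "eigenvalue_listing T m'" "v > 0"
  shows "card {k. m k = v} = card {k. m' k = v}"
  using assms unfolding eigenvalue_listing_def by (metis dim_span_eq_card_independent)

lemma eigenvalue_listing_unique:
  assumes m: "eigenvalue_listing T m" and m': "eigenvalue_listing T m'"
  shows "m = m'"
proof -
  \<comment> \<open>At a first index \<open>k\<close> with \<open>m' k < m k\<close>, the value \<open>m k\<close> would occur less often in \<open>m'\<close>.\<close>
  have le: "m k \<le> m' k"
    if m: "eigenvalue_listing T m" and m': "eigenvalue_listing T m'"
      and less: "\<And>j. j < k \<Longrightarrow> m j = m' j" for k m m'
  proof (rule ccontr)
    assume "\<not> m k \<le> m' k"
    then have k: "m' k < m k" by simp
    have "decseq m'" "m' k \<ge> 0"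
      using m' by (auto simp: eigenvalue_listing_def)
    \<comment> \<open>The value \<open>0\<close> may be listed infinitely often; only positive
      values have finite multiplicities to compare.\<close>
    with k have pos: "m k > 0" by linarith
    have "{j. m' j = m k} \<subseteq> {j. m j = m k}"
    proof clarify
      fix j assume j: "m' j = m k"
      have "j < k"
        using \<open>decseq m'\<close> k j by (metis decseqD leD leI)
      then show "m j = m k"
        using less j by simp
    qed
    moreover have "k \<in> {j. m j = m k} - {j. m' j = m k}"
      using k by simp
    moreover have "finite {j. m j = m k}"
      using m pos by (simp add: eigenvalue_listing_def)
    ultimately have "card {j. m' j = m k} < card {j. m j = m k}"
      by (intro psubset_card_mono) auto
    then show False
      using eigenvalue_listing_card_eq[OF m m' pos] by simp
  qed
  have "m k = m' k" for k
  proof (induction k rule: less_induct)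
    case (less k)
    then show ?case
      using le[OF m m', of k] le[OF m' m, of k] by force
  qed
  then show ?thesis by auto
qed

text \<open>Pairing \<open>diag_op e I d x = v x\<close> with \<open>e i\<close> kills every
  coordinate in \<open>I\<close> with \<open>d i \<noteq> v\<close>. As \<open>v \<noteq> 0\<close>,
  the vector \<open>x\<close> is a multiple of its image, a combination of the \<open>e i\<close>
  with \<open>i \<in> I\<close>.\<close>

lemma eigenspace_diag_op:
  assumes e: "complete_orthonormal e" and I: "finite I" and v: "v \<noteq> 0"
  shows "{x. diag_op e I d x = v *\<^sub>R x} = span (e ` {i \<in> I. d i = v})"
proof
  show "span (e ` {i \<in> I. d i = v}) \<subseteq> {x. diag_op e I d x = v *\<^sub>R x}"
  proof (rule span_minimal)
    show "e ` {i \<in> I. d i = v} \<subseteq> {x. diag_op e I d x = v *\<^sub>R x}"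
      by (auto simp: diag_op_basis[OF e I])
    show "subspace {x. diag_op e I d x = v *\<^sub>R x}"
      using bounded_linear.linear[OF bounded_linear_diag_op[of e I d]]
      by (auto simp: subspace_def linear_0 linear_add linear_scale scaleR_right_distrib)
  qed
  show "{x. diag_op e I d x = v *\<^sub>R x} \<subseteq> span (e ` {i \<in> I. d i = v})"
  proof
    fix x assume "x \<in> {x. diag_op e I d x = v *\<^sub>R x}"
    then have x: "v *\<^sub>R x = diag_op e I d x" by simp
    have zero: "d i * (x \<bullet> e i) = 0" if "i \<in> I" "d i \<noteq> v" for i
    proof -
      have "v * (x \<bullet> e i) = d i * (x \<bullet> e i)"
        using arg_cong[OF x, of "\<lambda>y. y \<bullet> e i"] that by (simp add: inner_diag_op[OF e I])
      then show ?thesis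
        using that by simp
    qed
    have "v *\<^sub>R x = (\<Sum>i\<in>I. (d i * (x \<bullet> e i)) *\<^sub>R e i)"
      using x by (simp add: diag_op_def)
    also have "\<dots> = (\<Sum>i\<in>{i \<in> I. d i = v}. (d i * (x \<bullet> e i)) *\<^sub>R e i)"
      using zero I by (intro sum.mono_neutral_right) auto
    also have "\<dots> \<in> span (e ` {i \<in> I. d i = v})"
      by (intro span_sum span_scale span_base) auto
    finally have "inverse v *\<^sub>R (v *\<^sub>R x) \<in> span (e ` {i \<in> I. d i = v})"
      by (rule span_scale)
    then show "x \<in> span (e ` {i \<in> I. d i = v})"
      using v by simp
  qed
qed

text \<open>The listing consists of the diagonal entries in descending order, continued by zeros;
  \<open>h\<close> is the enumeration of \<open>I\<close> that sorts them.\<close>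

lemma eigenvalue_listing_diag_op:
  assumes e: "complete_orthonormal e" and I: "finite I" and d: "\<And>i. i \<in> I \<Longrightarrow> d i \<ge> 0"
  obtains h m where "bij_betw h {..<card I} I" "eigenvalue_listing (diag_op e I d) m"
    "\<And>k. k < card I \<Longrightarrow> m k = d (h k)" "\<And>k. k \<ge> card I \<Longrightarrow> m k = 0"
proof -
  \<comment> \<open>\<open>sort_key\<close> sorts upwards, hence the negated key.\<close>
  define xs where "xs = sort_key (\<lambda>i. - d i) (sorted_list_of_set I)"
  have xs: "distinct xs" "set xs = I" "length xs = card I"
    using I by (auto simp: xs_def)
  have "sorted (map (\<lambda>i. - d i) xs)"
    by (simp add: xs_def)
  then have mono: "d (xs ! l) \<le> d (xs ! k)" if "k \<le> l" "l < card I" for k l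
    using that xs(3) by (auto simp: sorted_iff_nth_mono)
  define m where "m k = (if k < card I then d (xs ! k) else 0)" for k
  have bij: "bij_betw (\<lambda>k. xs ! k) {..<card I} I"
    using bij_betw_nth[OF xs(1) _ xs(2)[symmetric], of "{..<card I}"] xs(3) by simp
  have "eigenvalue_listing (diag_op e I d) m"
    unfolding eigenvalue_listing_def
  proof (intro conjI allI impI)
    have nonneg: "d (xs ! k) \<ge> 0" if "k < card I" for k
      using d bij that by (auto simp: bij_betw_def)
    then show "m k \<ge> 0" for k
      by (simp add: m_def)
    show "decseq m"
      using mono nonneg by (auto simp: decseq_def m_def)
    fix v :: real assume v: "v > 0"
    let ?J = "{i \<in> I. d i = v}"
    \<comment> \<open>As \<open>v\<close> is positive, the zero padding from \<open>card I\<close>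
      on contributes nothing.\<close>
    have eq: "{k. m k = v} = {k \<in> {..<card I}. d (xs ! k) = v}"
      using v by (auto simp: m_def)
    then show "finite {k. m k = v}" by simp
    have "bij_betw (\<lambda>k. xs ! k) {k. m k = v} ?J"
      unfolding eq using bij by (auto simp: bij_betw_def inj_on_def)
    then have "card {k. m k = v} = card ?J"
      by (rule bij_betw_same_card)
    moreover have "card (e ` ?J) = card ?J"
      using complete_orthonormal_inj[OF e] by (meson card_image inj_on_subset subset_UNIV)
    ultimately show "\<exists>b. finite b \<and> independent b \<and> span b = {x. diag_op e I d x = v *\<^sub>R x} \<and>
        card b = card {k. m k = v}"
      using eigenspace_diag_op[OF e I, of v d] complete_orthonormal_independent[OF e, of ?J] I v
      by (intro exI[of _ "e ` ?J"]) auto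
  qed
  then show thesis
    using that[of "\<lambda>k. xs ! k" m] bij by (auto simp: m_def)
qed

lemma kth_eigenvalue_diag_op:
  assumes e: "complete_orthonormal e" and I: "finite I" and d: "\<And>i. i \<in> I \<Longrightarrow> d i \<ge> 0"
  obtains h where "bij_betw h {..<card I} I"
    "\<And>k. 1 \<le> k \<Longrightarrow> k \<le> card I \<Longrightarrow> kth_eigenvalue k (diag_op e I d) = d (h (k - 1))"
    "\<And>k. k > card I \<Longrightarrow> kth_eigenvalue k (diag_op e I d) = 0"
    "\<And>k l. k \<le> l \<Longrightarrow> kth_eigenvalue l (diag_op e I d) \<le> kth_eigenvalue k (diag_op e I d)"
proof -
  obtain h m where h: "bij_betw h {..<card I} I" and m: "eigenvalue_listing (diag_op e I d) m"
    "\<And>k. k < card I \<Longrightarrow> m k = d (h k)" "\<And>k. k \<ge> card I \<Longrightarrow> m k = 0"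
    using eigenvalue_listing_diag_op[where d = d, OF e I d] by blast
  have "(THE m. eigenvalue_listing (diag_op e I d) m) = m"
    using m(1) eigenvalue_listing_unique by blast
  then have k: "kth_eigenvalue k (diag_op e I d) = m (k - 1)" for k
    by (simp add: kth_eigenvalue_def)
  \<comment> \<open>Truncated subtraction makes \<open>k - 1\<close> monotone in \<open>k\<close> on
    all naturals, so the order of \<open>m\<close> passes to the eigenvalues.\<close>
  have "m l \<le> m k" if "k \<le> l" for k l
    using m(1) that by (simp add: eigenvalue_listing_def decseqD)
  then show thesis
    using that[OF h] m by (simp add: k)
qed

text \<open>The first \<open>card I\<close> eigenvalues are the diagonal entries in some order,
  which the product does not see.\<close>

lemma prod_kth_eigenvalue_diag_op:
  assumes e: "complete_orthonormal e" and I: "finite I" and d: "\<And>i. i \<in> I \<Longrightarrow> d i \<ge> 0"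
  shows "(\<Prod>k=1..card I. kth_eigenvalue k (diag_op e I d)) = (\<Prod>i\<in>I. d i)"
proof -
  obtain h where h: "bij_betw h {..<card I} I"
    "\<And>k. 1 \<le> k \<Longrightarrow> k \<le> card I \<Longrightarrow> kth_eigenvalue k (diag_op e I d) = d (h (k - 1))"
    using kth_eigenvalue_diag_op[where d = d, OF e I d] by metis
  have "(\<Prod>k=1..card I. kth_eigenvalue k (diag_op e I d)) = (\<Prod>k=1..card I. d (h (k - 1)))"
    using h(2) by (intro prod.cong) auto
  also have "\<dots> = (\<Prod>k<card I. d (h k))"
    by (rule prod.reindex_bij_witness[of _ Suc "\<lambda>k. k - 1"]) auto
  also have "\<dots> = (\<Prod>i\<in>I. d i)"
    by (rule prod.reindex_bij_betw[OF h(1)])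
  finally show ?thesis .
qed

lemma card_kth_eigenvalue_pos:
  assumes e: "complete_orthonormal e" and I: "finite I" and d: "\<And>i. i \<in> I \<Longrightarrow> d i \<ge> 0"
    and pos: "kth_eigenvalue n (diag_op e I d) > 0"
  shows "n \<le> card I"
  using kth_eigenvalue_diag_op[where d = d, OF e I d] pos by (metis leI less_irrefl)

text \<open>The eigenvalue with number \<open>card I\<close> is the smallest diagonal entry.\<close>

lemma kth_eigenvalue_diag_op_pos_iff:
  assumes e: "complete_orthonormal e" and I: "finite I" "I \<noteq> {}" and d: "\<And>i. i \<in> I \<Longrightarrow> d i \<ge> 0"
  shows "kth_eigenvalue (card I) (diag_op e I d) > 0 \<longleftrightarrow> (\<forall>i\<in>I. d i > 0)"
proof -
  obtain h where h: "bij_betw h {..<card I} I"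
    and k: "\<And>k. 1 \<le> k \<Longrightarrow> k \<le> card I \<Longrightarrow> kth_eigenvalue k (diag_op e I d) = d (h (k - 1))"
    and mono: "\<And>k l. k \<le> l \<Longrightarrow> kth_eigenvalue l (diag_op e I d) \<le> kth_eigenvalue k (diag_op e I d)"
    using kth_eigenvalue_diag_op[where d = d, OF e I(1) d] by metis
  have n: "card I \<ge> 1"
    using I by (simp add: Suc_leI card_gt_0_iff)
  show ?thesis
  proof
    assume pos: "kth_eigenvalue (card I) (diag_op e I d) > 0"
    show "\<forall>i\<in>I. d i > 0"
    proof
      fix i assume "i \<in> I"
      then obtain j where j: "j < card I" "i = h j"
        using h by (auto simp: bij_betw_def)
      show "d i > 0"
        using k[of "Suc j"] mono[of "Suc j" "card I"] j pos by simp
    qed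
  next
    assume "\<forall>i\<in>I. d i > 0"
    moreover have "h (card I - 1) \<in> I"
      using h n by (auto simp: bij_betw_def)
    ultimately show "kth_eigenvalue (card I) (diag_op e I d) > 0"
      using k[of "card I"] n by simp
  qed
qed

section \<open>Dimension bound for the index set\<close>

lemma card_le_of_mem_span_orthonormal:
  assumes e: "complete_orthonormal e" and z: "complete_orthonormal z" and K: "finite K"
    and perp: "\<And>i x. i \<in> I \<Longrightarrow> x \<in> orthogonal_comp (span (z ` K)) \<Longrightarrow> x \<bullet> e i = 0"
  shows "card I \<le> card K"
proof -
  have mem: "e i \<in> span (z ` K)" if i: "i \<in> I" for i
  proof -
    \<comment> \<open>\<open>q\<close> is the orthogonal projection of \<open>e i\<close>. The
      remainder \<open>e i - q\<close> is orthogonal to \<open>q\<close>, and to \<open>e i\<close>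
      by \<open>perp\<close>, hence to itself.\<close>
    define q where "q = (\<Sum>k\<in>K. (e i \<bullet> z k) *\<^sub>R z k)"
    have q: "q \<in> span (z ` K)"
      unfolding q_def by (intro span_sum span_scale span_base) auto
    have "\<forall>y\<in>z ` K. orthogonal (e i - q) y"
    proof clarify
      fix k assume "k \<in> K"
      have "q \<bullet> z k = (\<Sum>l\<in>K. if l = k then e i \<bullet> z k else 0)"
        unfolding q_def inner_sum_left
        by (intro sum.cong) (auto simp: complete_orthonormal_inner[OF z])
      then show "orthogonal (e i - q) (z k)"
        using K \<open>k \<in> K\<close> by (simp add: orthogonal_def inner_diff_left)
    qed
    then have orth: "orthogonal (e i - q) y" if "y \<in> span (z ` K)" for y
      using that orthogonal_to_span by blast
    then have "e i - q \<in> orthogonal_comp (span (z ` K))"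
      by (auto simp: orthogonal_comp_def orthogonal_commute)
    then have "(e i - q) \<bullet> e i = 0"
      using perp i by blast
    moreover have "(e i - q) \<bullet> q = 0"
      using orth[OF q] by (simp add: orthogonal_def)
    ultimately have "(e i - q) \<bullet> (e i - q) = 0"
      by (simp add: inner_diff_right)
    then have "e i = q" by simp
    then show ?thesis
      using q by simp
  qed
  have "card (e ` I) \<le> card (z ` K)"
    using independent_span_bound[OF finite_imageI[OF K] complete_orthonormal_independent[OF e, of I], of z]
      mem by blast
  also have "\<dots> \<le> card K"
    using K by (rule card_image_le)
  also have "card (e ` I) = card I"
    using complete_orthonormal_inj[OF e] by (meson card_image inj_on_subset subset_UNIV)
  finally show ?thesis .
qed

section \<open>Strict optimality of uniform weights\<close>

text \<open>Take \<open>x = card I * p i\<close> in \<open>ln x \<le> x - 1\<close>. The right sides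
  sum to \<open>0\<close>, and equality holds only at \<open>x = 1\<close>, so one deviating weight
  makes the sum strict.\<close>

lemma sum_ln_less_uniform:
  fixes p :: "'b \<Rightarrow> real"
  assumes I: "finite I" and pos: "\<And>i. i \<in> I \<Longrightarrow> p i > 0" and sum: "sum p I = 1"
    and neq: "\<exists>i\<in>I. p i \<noteq> 1 / card I"
  shows "(\<Sum>i\<in>I. ln (p i)) < (\<Sum>i\<in>I. ln (1 / card I))"
proof -
  have n: "card I > 0"
    using I neq by (auto simp: card_gt_0_iff)
  have "(\<Sum>i\<in>I. ln (card I * p i)) < (\<Sum>i\<in>I. card I * p i - 1)"
  proof (rule sum_strict_mono_ex1[OF I])
    show "\<forall>i\<in>I. ln (card I * p i) \<le> card I * p i - 1"
      using pos n by (auto intro!: ln_le_minus_one)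
    obtain i where i: "i \<in> I" "p i \<noteq> 1 / card I"
      using neq by blast
    then have "card I * p i \<noteq> 1"
      using n by (auto simp: field_simps)
    then have "ln (card I * p i) \<noteq> card I * p i - 1"
      using ln_eq_minus_one[of "card I * p i"] pos[OF i(1)] n by auto
    moreover have "ln (card I * p i) \<le> card I * p i - 1"
      using pos[OF i(1)] n by (auto intro!: ln_le_minus_one)
    ultimately show "\<exists>i\<in>I. ln (card I * p i) < card I * p i - 1"
      using i(1) by force
  qed
  also have "\<dots> = 0"
    using sum by (simp add: sum_subtractf flip: sum_distrib_left)
  finally have "(\<Sum>i\<in>I. ln (card I * p i)) < 0" .
  moreover have "(\<Sum>i\<in>I. ln (card I * p i)) = (\<Sum>i\<in>I. ln (card I) + ln (p i))"
    using pos n by (intro sum.cong refl ln_mult_pos) auto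
  ultimately show ?thesis
    using n by (simp add: sum.distrib ln_div)
qed

section \<open>Diagonal Gramians, the feasible set and its minimizer\<close>

theorem mainTheorem3:
  fixes S :: "real \<Rightarrow> 'a::{real_inner, complete_space, second_countable_topology} \<Rightarrow>\<^sub>L 'a"
    and D :: "'a set" and A :: "'a \<Rightarrow> 'a"
    and e z :: "nat \<Rightarrow> 'a"
    and ev :: "nat \<Rightarrow> real" and lam :: "nat \<Rightarrow> nat \<Rightarrow> real"
    and n :: nat and I :: "nat set" and p :: "nat \<Rightarrow> real"
  assumes "complete_orthonormal e"
    and "c0_semigroup S" and "exponentially_stable S" and "is_generator D A S"
    and "self_adjoint_on D A"
    and "\<And>i. e i \<in> D \<and> A (e i) = ev i *\<^sub>R e i"
    and "n \<ge> 1" and "finite I"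
    and "feasible S e n I \<noteq> {}"
    and "\<And>i j. gramian_i S e i \<circ> gramian_i S e j = gramian_i S e j \<circ> gramian_i S e i"
    and "complete_orthonormal z"
    and "\<And>i k. lam i k \<ge> 0"
    and "\<And>i x. (\<lambda>k. (lam i k * (x \<bullet> z k)) *\<^sub>R z k) sums gramian_i S e i x"
    and "\<exists>\<sigma>. inj_on \<sigma> {1..n} \<and>
           (\<forall>i\<in>I. \<forall>x\<in>orthogonal_comp (span ((\<lambda>k. z (\<sigma> k)) ` {1..n})). gramian_i S e i x = 0)"
  shows "is_arg_min (vol_objective S e n) (\<lambda>p. p \<in> feasible S e n I) p \<longleftrightarrow>
         p = (\<lambda>i. if i \<in> I then 1 / real n else 0)"
proof -
  note e = assms(1) and I = assms(8)
  obtain M w where M: "M > 0" and w: "w > 0" and bound: "\<And>t. t \<ge> 0 \<Longrightarrow> norm (S t) \<le> M * exp (- w * t)"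
    using assms(3) by (auto simp: exponentially_stable_def)
  have norm_e: "norm (e i) = 1" for i
    using complete_orthonormal_inner[OF e, of i i] by (simp add: norm_eq_1)
  have S: "S t (e i) = exp (ev i * t) *\<^sub>R e i" if "t \<ge> 0" for t i
  proof (rule semigroup_eigenvector[OF assms(2) _ _ that])
    show "norm (S t) \<le> M" if "t \<ge> 0" for t
    proof -
      have "M * exp (- w * t) \<le> M * 1"
        using M w that by (intro mult_left_mono) auto
      then show ?thesis
        using bound[OF that] by simp
    qed
    show "((\<lambda>h. (S h (e i) - e i) /\<^sub>R h) \<longlongrightarrow> ev i *\<^sub>R e i) (at_right 0)"
      using assms(4) assms(6)[of i] unfolding is_generator_def by metis
  qed
  \<comment> \<open>Stability applied to the unit vector \<open>e i\<close> gives
    \<open>exp (ev i * t) \<le> M * exp (- w * t)\<close>. The right side tends to \<open>0\<close>,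
    while the left stays at least \<open>1\<close> if \<open>ev i \<ge> 0\<close>.\<close>
  have ev: "ev i < 0" for i
  proof (rule ccontr)
    assume "\<not> ev i < 0"
    have "exp (ev i * t) \<le> M * exp (- w * t)" if t: "t \<ge> 0" for t
      using norm_blinfun[of "S t" "e i"] bound[OF t] by (simp add: S t norm_e)
    moreover have "1 \<le> exp (ev i * t)" if "t \<ge> 0" for t
      using \<open>\<not> ev i < 0\<close> that by simp
    ultimately have "1 \<le> M * exp (- w * t)" if "t \<ge> 0" for t
      using that by (meson order_trans)
    moreover have "((\<lambda>t. M * exp (- w * t)) \<longlongrightarrow> M * 0) at_top"
      using w by (intro tendsto_intros filterlim_compose[OF exp_at_bot])
        (auto simp: filterlim_uminus_at_bot
          intro!: filterlim_tendsto_pos_mult_at_top filterlim_ident tendsto_const)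
    ultimately have "(1::real) \<le> M * 0"
      by (intro tendsto_lowerbound[where F = at_top])
        (auto intro: eventually_mono[OF eventually_ge_at_top[of 0]])
    then show False by simp
  qed
  \<comment> \<open>\<open>c i\<close> is the only nonzero eigenvalue of
    \<open>gramian_i S e i\<close>, that is, the Gramian entry for unit weight.\<close>
  define c where "c i = 1 / (- 2 * ev i)" for i
  have c: "c i > 0" for i
    using ev[of i] by (simp add: c_def divide_neg_neg)
  have W: "gramian S e q = diag_op e I (\<lambda>i. q i * c i)"
    if "q \<in> prob_seqs" "\<And>i. i \<notin> I \<Longrightarrow> q i = 0" for q
  proof -
    have "(sqrt (q i))\<^sup>2 / (- 2 * ev i) = q i * c i" for i
      using that(1) by (simp add: prob_seqs_def c_def)
    then show ?thesis
      using input_op_eq_diag_op[of e I q, OF e I that(2)]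
        gramian_of_diag_op[of e I S ev "\<lambda>i. sqrt (q i)", OF e I S ev]
      by (simp add: gramian_def)
  qed
  have W_i: "gramian_i S e i x = (c i * (x \<bullet> e i)) *\<^sub>R e i" for i x
  proof -
    have "coord_proj e i = diag_op e {i} (\<lambda>_. 1)"
      by (simp add: fun_eq_iff coord_proj_def diag_op_def)
    then show ?thesis
      using gramian_of_diag_op[where I = "{i}" and s = "\<lambda>_. 1", OF e _ S ev]
      by (simp add: gramian_i_def diag_op_def c_def)
  qed
  obtain q0 where q0: "q0 \<in> prob_seqs" "\<And>i. i \<notin> I \<Longrightarrow> q0 i = 0" "kth_eigenvalue n (gramian S e q0) > 0"
    using assms(9) by (auto simp: feasible_def positive_nth_def)
  \<comment> \<open>The Gramian at the feasible point \<open>q0\<close> has at most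
    \<open>card I\<close> positive eigenvalues, and the \<open>n\<close>-th is one of them.\<close>
  have "n \<le> card I"
    using q0 c by (intro card_kth_eigenvalue_pos[OF e I, of "\<lambda>i. q0 i * c i"])
      (auto simp: W prob_seqs_def less_imp_le)
  moreover have "card I \<le> n"
  proof -
    obtain \<sigma> where \<sigma>: "\<forall>i\<in>I. \<forall>x\<in>orthogonal_comp (span ((\<lambda>k. z (\<sigma> k)) ` {1..n})). gramian_i S e i x = 0"
      using assms(14) by blast
    \<comment> \<open>\<open>gramian_i S e i\<close> has rank one with \<open>c i > 0\<close>, so
      its kernel is the orthogonal complement of \<open>e i\<close>.\<close>
    have "x \<bullet> e i = 0" if "i \<in> I" "x \<in> orthogonal_comp (span (z ` \<sigma> ` {1..n}))" for i x
    proof -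
      have "gramian_i S e i x = 0"
        using \<sigma>[rule_format, of i x] that by (simp add: image_image)
      then show ?thesis
        using c[of i] norm_e[of i] by (auto simp: W_i)
    qed
    then have "card I \<le> card (\<sigma> ` {1..n})"
      by (intro card_le_of_mem_span_orthonormal[OF e assms(11)]) auto
    also have "\<dots> \<le> card {1..n}"
      by (rule card_image_le) simp
    finally show ?thesis by simp
  qed
  ultimately have n: "card I = n" by simp
  then have "I \<noteq> {}"
    using assms(7) by auto
  \<comment> \<open>With \<open>card I = n\<close>, the \<open>n\<close>-th eigenvalue is the
    smallest \<open>q i * c i\<close>, so the spectral constraint says that all weights on
    \<open>I\<close> are positive.\<close>
  have feasible: "q \<in> feasible S e n I \<longleftrightarrow>
      q \<in> prob_seqs \<and> (\<forall>i\<in>I. q i > 0) \<and> (\<forall>i. i \<notin> I \<longrightarrow> q i = 0)" for q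
  proof -
    have "kth_eigenvalue n (gramian S e q) > 0 \<longleftrightarrow> (\<forall>i\<in>I. q i > 0)"
      if q: "q \<in> prob_seqs" "\<forall>i. i \<notin> I \<longrightarrow> q i = 0"
    proof -
      have "kth_eigenvalue n (gramian S e q) > 0 \<longleftrightarrow> (\<forall>i\<in>I. q i * c i > 0)"
        using kth_eigenvalue_diag_op_pos_iff[OF e I \<open>I \<noteq> {}\<close>, of "\<lambda>i. q i * c i"] q c
        by (simp add: W n prob_seqs_def less_imp_le)
      moreover have "q i * c i > 0 \<longleftrightarrow> q i > 0" for i
        using c[of i] by (auto simp: zero_less_mult_iff dest: less_asym)
      ultimately show ?thesis by simp
    qed
    then show ?thesis
      by (auto simp: feasible_def positive_nth_def)
  qed
  have obj: "vol_objective S e n q = - (\<Sum>i\<in>I. ln (q i)) - (\<Sum>i\<in>I. ln (c i))"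
    if q: "q \<in> feasible S e n I" for q
  proof -
    have q': "q \<in> prob_seqs" "\<And>i. i \<in> I \<Longrightarrow> q i > 0" "\<And>i. i \<notin> I \<Longrightarrow> q i = 0"
      using q by (auto simp: feasible)
    have "(\<Prod>k=1..n. kth_eigenvalue k (gramian S e q)) = (\<Prod>i\<in>I. q i * c i)"
      using prod_kth_eigenvalue_diag_op[OF e I, of "\<lambda>i. q i * c i"] q' c
      by (simp add: W n less_imp_le)
    moreover have "ln (\<Prod>i\<in>I. q i * c i) = (\<Sum>i\<in>I. ln (q i * c i))"
      using I q'(2) c by (intro ln_prod) (auto simp: less_imp_neq[symmetric])
    moreover have "(\<Sum>i\<in>I. ln (q i * c i)) = (\<Sum>i\<in>I. ln (q i) + ln (c i))"
      using q'(2) c by (intro sum.cong refl ln_mult_pos) auto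
    ultimately show ?thesis
      by (simp add: vol_objective_def sum.distrib)
  qed
  define u where "u = (\<lambda>i. if i \<in> I then 1 / real n else 0)"
  have sums_I: "q sums sum q I" if "\<And>i. i \<notin> I \<Longrightarrow> q i = 0" for q :: "nat \<Rightarrow> real"
    using I that by (rule sums_finite)
  have "sum u I = 1"
    using n assms(7) by (simp add: u_def)
  then have "u sums 1"
    using sums_I[of u] by (simp add: u_def)
  then have u: "u \<in> feasible S e n I"
    unfolding feasible using assms(7) by (simp add: prob_seqs_def u_def)
  \<comment> \<open>The strict inequality gives optimality of \<open>u\<close> and uniqueness at
    once, as the equivalence in the conclusion requires.\<close>
  have less: "vol_objective S e n u < vol_objective S e n q" if q: "q \<in> feasible S e n I" "q \<noteq> u" for q
  proof -
    have q': "q sums 1" "\<And>i. i \<in> I \<Longrightarrow> q i > 0" "\<And>i. i \<notin> I \<Longrightarrow> q i = 0"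
      using q(1) by (auto simp: feasible prob_seqs_def)
    have "sum q I = 1"
      using sums_I q' sums_unique2 by blast
    \<comment> \<open>Both \<open>q\<close> and \<open>u\<close> vanish outside \<open>I\<close>, so
      they differ at an index in \<open>I\<close>.\<close>
    moreover have "\<exists>i\<in>I. q i \<noteq> 1 / real (card I)"
      using q(2) q'(3) by (auto simp: u_def n fun_eq_iff split: if_splits)
    ultimately have "(\<Sum>i\<in>I. ln (q i)) < (\<Sum>i\<in>I. ln (1 / real (card I)))"
      using q'(2) by (intro sum_ln_less_uniform[OF I])
    moreover have "(\<Sum>i\<in>I. ln (u i)) = (\<Sum>i\<in>I. ln (1 / real (card I)))"
      by (intro sum.cong) (auto simp: u_def n)
    ultimately show ?thesis
      by (simp add: obj q(1) u)
  qed
  have "is_arg_min (vol_objective S e n) (\<lambda>p. p \<in> feasible S e n I) p \<longleftrightarrow> p = u"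
    unfolding is_arg_min_def using less u by (metis less_asym)
  then show ?thesis
    by (simp add: u_def)
qed

end
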